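(* Let $\pi_1,\pi_2\in\mathbb Z[i]$ be relatively prime primary primes whose norms are both congruent to $5$ modulo $8$, and let $\nu=\pi_1\pi_2$. Let $\xi_1,\xi_2\in\mathbb Z[i]$ satisfy $\xi_1+\xi_2=1$, $\pi_2\mid \xi_1$, $\pi_1\mid\xi_2$, and put $\xi=\xi_1-\xi_2$ (so that $\xi^2\equiv 1 \bmod \nu$). Let $\beta$ be a quadratic residue modulo $\nu$ (relatively prime to $\nu$), and let $\gamma\in\mathbb Z[i]$ with $\gamma^2\equiv\beta \bmod \nu$, so that the four square roots of $\beta$ modulo $\nu$ are represented by $\gamma,-\gamma,\gamma\xi,-\gamma\xi$. For $\alpha\in\{\gamma,-\gamma,\gamma\xi,-\gamma\xi\}$ define two bits: $b_0(\alpha)=1$ if $\Re(\alpha)>0$ and $b_0(\alpha)=0$ if $\Re(\alpha)<0$ (when $\Re(\alpha)=0$, the same rule is applied with $\Im(\alpha)$ in place of $\Re(\alpha)$); and $b_1(\alpha)=1$ if $\left[\frac{\alpha}{\nu}\right]_4\in\{1,i\}$, $b_1(\alpha)=0$ if $\left[\frac{\alpha}{\nu}\right]_4\in\{-1,-i\}$. Then the pair $(b_0(\alpha),b_1(\alpha))$ uniquely identifies $\alpha$ among the four square roots $\gamma,-\gamma,\gamma\xi,-\gamma\xi$.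
   Context: $\mathbb Z[i]$ is the ring of Gaussian integers, with norm $\mathcal N(x+iy)=x^2+y^2$. An element is odd if it is not divisible by $1+i$. An element $z\in\mathbb Z[i]$ is primary if $z\equiv 1 \bmod (1+i)^3$. For an odd irreducible $\pi\in\mathbb Z[i]$ and $\alpha\in\mathbb Z[i]$, the quartic residue symbol $\left[\frac{\alpha}{\pi}\right]_4$ is $0$ if $\pi\mid\alpha$, and otherwise is the unique $i^j\in\{1,i,-1,-i\}$ with $\alpha^{(\mathcal N(\pi)-1)/4}\equiv i^j \bmod \pi$. For $\nu=\pi_1\pi_2$ the Gauss-Jacobi symbol is defined multiplicatively: $\left[\frac{\alpha}{\nu}\right]_4=\left[\frac{\alpha}{\pi_1}\right]_4\left[\frac{\alpha}{\pi_2}\right]_4$. *)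

theory Defs
  imports "HOL-Computational_Algebra.Euclidean_Algorithm"
begin

section \<open>The ring of Gaussian integers\<close>

datatype gauss_int = Gauss_Int (ReZ: int) (ImZ: int)

lemma gauss_int_eq_iff: "x = y \<longleftrightarrow> ReZ x = ReZ y \<and> ImZ x = ImZ y"
  by (cases x; cases y) auto

instantiation gauss_int :: comm_ring_1
begin

definition "0 = Gauss_Int 0 0"
definition "1 = Gauss_Int 1 0"
definition "x + y = Gauss_Int (ReZ x + ReZ y) (ImZ x + ImZ y)"
definition "- x = Gauss_Int (- ReZ x) (- ImZ x)"
definition "x - y = Gauss_Int (ReZ x - ReZ y) (ImZ x - ImZ y)"
definition "x * y = Gauss_Int (ReZ x * ReZ y - ImZ x * ImZ y) (ReZ x * ImZ y + ImZ x * ReZ y)"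

instance
  by standard
    (auto simp: zero_gauss_int_def one_gauss_int_def plus_gauss_int_def uminus_gauss_int_def
      minus_gauss_int_def times_gauss_int_def algebra_simps)

end

lemma ReZ_simps [simp]:
  "ReZ 0 = 0" "ReZ 1 = 1" "ReZ (x + y) = ReZ x + ReZ y" "ReZ (- x) = - ReZ x"
  "ReZ (x - y) = ReZ x - ReZ y" "ReZ (x * y) = ReZ x * ReZ y - ImZ x * ImZ y"
  by (simp_all add: zero_gauss_int_def one_gauss_int_def plus_gauss_int_def uminus_gauss_int_def
      minus_gauss_int_def times_gauss_int_def)

lemma ImZ_simps [simp]:
  "ImZ 0 = 0" "ImZ 1 = 0" "ImZ (x + y) = ImZ x + ImZ y" "ImZ (- x) = - ImZ x"
  "ImZ (x - y) = ImZ x - ImZ y" "ImZ (x * y) = ReZ x * ImZ y + ImZ x * ReZ y"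
  by (simp_all add: zero_gauss_int_def one_gauss_int_def plus_gauss_int_def uminus_gauss_int_def
      minus_gauss_int_def times_gauss_int_def)

definition gauss_i :: gauss_int  (\<open>\<i>\<^sub>\<int>\<close>)
  where "\<i>\<^sub>\<int> = Gauss_Int 0 1"

definition gauss_cnj :: "gauss_int \<Rightarrow> gauss_int"
  where "gauss_cnj z = Gauss_Int (ReZ z) (- ImZ z)"

definition gauss_norm :: "gauss_int \<Rightarrow> int"
  where "gauss_norm z = ReZ z ^ 2 + ImZ z ^ 2"

lemma ReZ_ImZ_aux [simp]:
  "ReZ \<i>\<^sub>\<int> = 0" "ImZ \<i>\<^sub>\<int> = 1" "ReZ (gauss_cnj z) = ReZ z" "ImZ (gauss_cnj z) = - ImZ z"
  by (simp_all add: gauss_i_def gauss_cnj_def)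

lemma gauss_norm_0 [simp]: "gauss_norm 0 = 0" and gauss_norm_1 [simp]: "gauss_norm 1 = 1"
  by (simp_all add: gauss_norm_def)

lemma gauss_norm_mult: "gauss_norm (x * y) = gauss_norm x * gauss_norm y"
  by (simp add: gauss_norm_def power2_eq_square algebra_simps)

lemma gauss_norm_cnj [simp]: "gauss_norm (gauss_cnj z) = gauss_norm z"
  by (simp add: gauss_norm_def)

lemma gauss_norm_nonneg [simp]: "gauss_norm z \<ge> 0"
  by (simp add: gauss_norm_def)

lemma gauss_norm_eq_0_iff [simp]: "gauss_norm z = 0 \<longleftrightarrow> z = 0"
  by (simp add: gauss_norm_def gauss_int_eq_iff sum_power2_eq_zero_iff)

lemma gauss_norm_pos_iff [simp]: "gauss_norm z > 0 \<longleftrightarrow> z \<noteq> 0"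
  using gauss_norm_nonneg[of z] gauss_norm_eq_0_iff[of z] by linarith

instance gauss_int :: idom
proof
  fix x y :: gauss_int
  assume "x \<noteq> 0" "y \<noteq> 0"
  then have "gauss_norm (x * y) \<noteq> 0"
    by (simp add: gauss_norm_mult)
  then show "x * y \<noteq> 0"
    by auto
qed

section \<open>Division with remainder and normalisation\<close>

definition round_div :: "int \<Rightarrow> int \<Rightarrow> int"
  where "round_div m n = (2 * m + n) div (2 * n)"

lemma round_div_mult [simp]: "n > 0 \<Longrightarrow> round_div (m * n) n = m"
  unfolding round_div_def
  by (rule int_div_pos_eq[where r = n]) (simp_all add: algebra_simps)

lemma round_div_diff: 
  assumes "n > 0"
  shows "(2 * (m - round_div m n * n)) ^ 2 \<le> n ^ 2"
proof -
  define q where "q = round_div m n"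
  have "2 * m + n = q * (2 * n) + (2 * m + n) mod (2 * n)"
    unfolding q_def round_div_def by (rule div_mult_mod_eq[symmetric])
  moreover have "0 \<le> (2 * m + n) mod (2 * n)" "(2 * m + n) mod (2 * n) < 2 * n"
    using assms by simp_all
  ultimately have "- n \<le> 2 * (m - q * n)" "2 * (m - q * n) \<le> n"
    by (simp_all add: algebra_simps)
  then have "\<bar>2 * (m - q * n)\<bar> \<le> \<bar>n\<bar>"
    by linarith
  then show ?thesis
    unfolding q_def abs_le_square_iff .
qed

text \<open>The unit factor selects the associate in the quadrant Re > 0, Im \<open>\<ge>\<close> 0.\<close>

instantiation gauss_int :: normalization_euclidean_semiring
begin

definition divide_gauss_int :: "gauss_int \<Rightarrow> gauss_int \<Rightarrow> gauss_int"
  where "divide_gauss_int x y =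
    Gauss_Int (round_div (ReZ (x * gauss_cnj y)) (gauss_norm y))
              (round_div (ImZ (x * gauss_cnj y)) (gauss_norm y))"

definition modulo_gauss_int :: "gauss_int \<Rightarrow> gauss_int \<Rightarrow> gauss_int"
  where "modulo_gauss_int x y = x - x div y * y"

definition unit_factor_gauss_int :: "gauss_int \<Rightarrow> gauss_int"
  where "unit_factor_gauss_int z =
    (if z = 0 then 0
     else if ReZ z > 0 \<and> ImZ z \<ge> 0 then 1
     else if ReZ z \<le> 0 \<and> ImZ z > 0 then \<i>\<^sub>\<int>
     else if ReZ z < 0 \<and> ImZ z \<le> 0 then - 1
     else - \<i>\<^sub>\<int>)"

definition normalize_gauss_int :: "gauss_int \<Rightarrow> gauss_int"
  where "normalize_gauss_int z = gauss_cnj (unit_factor z) * z"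

definition euclidean_size_gauss_int :: "gauss_int \<Rightarrow> nat"
  where "euclidean_size_gauss_int z = nat (gauss_norm z)"

lemma gauss_unit_cases:
  assumes "(z :: gauss_int) dvd 1"
  shows "z = 1 \<or> z = \<i>\<^sub>\<int> \<or> z = - 1 \<or> z = - \<i>\<^sub>\<int>"
proof -
  from assms obtain w where "1 = z * w" ..
  then have "gauss_norm z * gauss_norm w = 1"
    by (metis gauss_norm_1 gauss_norm_mult)
  then have *: "ReZ z ^ 2 + ImZ z ^ 2 = 1"
    using gauss_norm_nonneg[of z] unfolding gauss_norm_def by (auto simp: zmult_eq_1_iff)
  have "ReZ z ^ 2 \<le> 1" "ImZ z ^ 2 \<le> 1"
    by (simp_all flip: *)
  then have "\<bar>ReZ z\<bar> \<le> 1" "\<bar>ImZ z\<bar> \<le> 1"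
    using abs_le_square_iff[of "ReZ z" 1] abs_le_square_iff[of "ImZ z" 1] by simp_all
  then have "ReZ z = -1 \<or> ReZ z = 0 \<or> ReZ z = 1" "ImZ z = -1 \<or> ImZ z = 0 \<or> ImZ z = 1"
    by linarith+
  with * show ?thesis
    by (auto simp: gauss_int_eq_iff)
qed

lemma gauss_unitsI: "\<i>\<^sub>\<int> dvd 1" "- \<i>\<^sub>\<int> dvd 1"
proof -
  have "1 = \<i>\<^sub>\<int> * (- \<i>\<^sub>\<int>)"
    by (simp add: gauss_int_eq_iff)
  then show "\<i>\<^sub>\<int> dvd 1" "- \<i>\<^sub>\<int> dvd 1"
    by (metis dvd_triv_left dvd_triv_right)+
qed

instance
proof
  fix a b :: gauss_int
  show "a div 0 = 0"
    by (simp add: divide_gauss_int_def round_div_def gauss_int_eq_iff)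
  show "a * b div b = a" if "b \<noteq> 0"
  proof -
    have "a * b * gauss_cnj b = Gauss_Int (ReZ a * gauss_norm b) (ImZ a * gauss_norm b)"
      by (simp add: gauss_int_eq_iff gauss_norm_def power2_eq_square algebra_simps)
    with that show ?thesis
      by (simp add: divide_gauss_int_def gauss_int_eq_iff del: ReZ_simps ImZ_simps)
  qed
  show "a div b * b + a mod b = a"
    by (simp add: modulo_gauss_int_def)
  show "euclidean_size (0 :: gauss_int) = 0"
    by (simp add: euclidean_size_gauss_int_def)
  show "euclidean_size (a mod b) < euclidean_size b" if "b \<noteq> 0"
  proof -
    let ?N = "gauss_norm b" and ?c = "a * gauss_cnj b"
    have N: "?N > 0"
      using that by simp
    have eq: "(a mod b) * gauss_cnj b =
        Gauss_Int (ReZ ?c - round_div (ReZ ?c) ?N * ?N) (ImZ ?c - round_div (ImZ ?c) ?N * ?N)"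
    proof -
      have "b * gauss_cnj b = Gauss_Int ?N 0"
        by (simp add: gauss_int_eq_iff gauss_norm_def power2_eq_square)
      moreover have "(a mod b) * gauss_cnj b = ?c - a div b * (b * gauss_cnj b)"
        by (simp only: modulo_gauss_int_def left_diff_distrib mult.assoc)
      ultimately show ?thesis
        unfolding divide_gauss_int_def
        by (simp add: minus_gauss_int_def times_gauss_int_def del: ReZ_simps ImZ_simps)
    qed
    have "4 * (gauss_norm (a mod b) * ?N) = 4 * gauss_norm ((a mod b) * gauss_cnj b)"
      by (simp add: gauss_norm_mult)
    also have "\<dots> = (2 * (ReZ ?c - round_div (ReZ ?c) ?N * ?N)) ^ 2 +
                     (2 * (ImZ ?c - round_div (ImZ ?c) ?N * ?N)) ^ 2"
      unfolding eq gauss_norm_def[of "Gauss_Int _ _"]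
      by (simp only: gauss_int.sel power_mult_distrib) simp
    also have "\<dots> \<le> ?N ^ 2 + ?N ^ 2"
      by (intro add_mono round_div_diff N)
    also have "\<dots> < 4 * (?N * ?N)"
      using N by (simp add: power2_eq_square)
    finally have "gauss_norm (a mod b) * ?N < ?N * ?N"
      by simp
    then have "gauss_norm (a mod b) < ?N"
      using N by (simp only: mult_less_cancel_right_pos)
    then show ?thesis
      using N by (simp add: euclidean_size_gauss_int_def del: gauss_norm_pos_iff)
  qed
  show "euclidean_size a \<le> euclidean_size (a * b)" if "b \<noteq> 0"
  proof -
    have "gauss_norm a * 1 \<le> gauss_norm a * gauss_norm b"
      using that gauss_norm_pos_iff[of b]
      by (intro mult_left_mono) (simp_all del: gauss_norm_pos_iff)
    then show ?thesis
      by (simp add: euclidean_size_gauss_int_def gauss_norm_mult)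
  qed
  show "unit_factor (0 :: gauss_int) = 0"
    by (simp add: unit_factor_gauss_int_def)
  show "unit_factor a = a" if "a dvd 1"
    using gauss_unit_cases[OF that] by (auto simp: unit_factor_gauss_int_def gauss_int_eq_iff)
  show "unit_factor a dvd 1" if "a \<noteq> 0"
    using that gauss_unitsI by (simp add: unit_factor_gauss_int_def)
  show "unit_factor (a * b) = a * unit_factor b" if "a dvd 1"
  proof -
    consider "b = 0" | "ReZ b > 0" "ImZ b \<ge> 0" | "ReZ b \<le> 0" "ImZ b > 0"
      | "ReZ b < 0" "ImZ b \<le> 0" | "ReZ b \<ge> 0" "ImZ b < 0"
      unfolding gauss_int_eq_iff ReZ_simps ImZ_simps by linarith
    then show ?thesis
      using gauss_unit_cases[OF that]
      by cases (elim disjE; simp add: unit_factor_gauss_int_def gauss_int_eq_iff)+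
  qed
  show "unit_factor a * normalize a = a"
    by (auto simp: normalize_gauss_int_def unit_factor_gauss_int_def gauss_int_eq_iff)
  show "normalize (0 :: gauss_int) = 0"
    by (simp add: normalize_gauss_int_def)
qed

end

section \<open>Congruences, primary elements and the quartic symbol\<close>

text \<open>
  The library's \<open>cong\<close> is restricted to rings with a canonical division with remainder
  (class \<^class>\<open>unique_euclidean_semiring\<close>), so congruence is introduced separately here.
\<close>

definition gauss_cong :: "gauss_int \<Rightarrow> gauss_int \<Rightarrow> gauss_int \<Rightarrow> bool"
    (\<open>(1[_ = _] '(gmod _'))\<close>)
  where "[a = b] (gmod m) \<longleftrightarrow> m dvd a - b"

definition primary :: "gauss_int \<Rightarrow> bool"
  where "primary z \<longleftrightarrow> [z = 1] (gmod (1 + \<i>\<^sub>\<int>) ^ 3)"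

definition gauss_quad_residue :: "gauss_int \<Rightarrow> gauss_int \<Rightarrow> bool"
  where "gauss_quad_residue \<nu> \<beta> \<longleftrightarrow> coprime \<beta> \<nu> \<and> (\<exists>x. [x ^ 2 = \<beta>] (gmod \<nu>))"

text \<open>Only meaningful if \<open>\<pi>\<close> is an odd irreducible element.\<close>

definition quartic_symbol :: "gauss_int \<Rightarrow> gauss_int \<Rightarrow> gauss_int"
  where "quartic_symbol \<alpha> \<pi> =
    (if \<pi> dvd \<alpha> then 0
     else (THE u. u \<in> {1, \<i>\<^sub>\<int>, - 1, - \<i>\<^sub>\<int>} \<and>
                  [\<alpha> ^ nat ((gauss_norm \<pi> - 1) div 4) = u] (gmod \<pi>)))"

text \<open>
  Only meaningful if \<open>\<nu>\<close> is odd. The prime factors in \<^const>\<open>prime_factorization\<close> are normalised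
  to the quadrant Re > 0, Im \<open>\<ge>\<close> 0; this is harmless since the quartic symbol does not
  change when its modulus is replaced by an associate (see \<open>gauss_jacobi_mult_primes\<close> below).
\<close>

definition gauss_jacobi :: "gauss_int \<Rightarrow> gauss_int \<Rightarrow> gauss_int"
  where "gauss_jacobi \<alpha> \<nu> = (\<Prod>\<pi>\<in>#prime_factorization \<nu>. quartic_symbol \<alpha> \<pi>)"

lemma quartic_symbol_normalize [simp]: "quartic_symbol \<alpha> (normalize \<pi>) = quartic_symbol \<alpha> \<pi>"
proof -
  have "gauss_norm (normalize \<pi>) = gauss_norm \<pi>"
    by (auto simp: normalize_gauss_int_def unit_factor_gauss_int_def gauss_norm_def gauss_int_eq_iff)
  then show ?thesis
    by (simp add: quartic_symbol_def gauss_cong_def)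
qed

lemma gauss_jacobi_prime: "prime_elem \<pi> \<Longrightarrow> gauss_jacobi \<alpha> \<pi> = quartic_symbol \<alpha> \<pi>"
  using prime_factorization_prime[of "normalize \<pi>"] by (simp add: gauss_jacobi_def)

lemma gauss_jacobi_mult:
  "\<mu> \<noteq> 0 \<Longrightarrow> \<nu> \<noteq> 0 \<Longrightarrow> gauss_jacobi \<alpha> (\<mu> * \<nu>) = gauss_jacobi \<alpha> \<mu> * gauss_jacobi \<alpha> \<nu>"
  by (simp add: gauss_jacobi_def prime_factorization_mult)

lemma gauss_jacobi_mult_primes:
  assumes "prime_elem \<pi>1" "prime_elem \<pi>2"
  shows "gauss_jacobi \<alpha> (\<pi>1 * \<pi>2) = quartic_symbol \<alpha> \<pi>1 * quartic_symbol \<alpha> \<pi>2"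
  using assms by (simp add: gauss_jacobi_mult gauss_jacobi_prime prime_elem_not_zeroI)

section \<open>The two identifying bits\<close>

text \<open>
  The bits carry no information where they are \<^const>\<open>undefined\<close>: for \<open>\<alpha> = 0\<close>, respectively
  for \<open>\<alpha>\<close> whose symbol modulo \<open>\<nu>\<close> vanishes.
\<close>

definition bit_b0 :: "gauss_int \<Rightarrow> nat"
  where "bit_b0 \<alpha> =
    (if ReZ \<alpha> > 0 then 1
     else if ReZ \<alpha> < 0 then 0
     else if ImZ \<alpha> > 0 then 1
     else if ImZ \<alpha> < 0 then 0
     else undefined)"

definition bit_b1 :: "gauss_int \<Rightarrow> gauss_int \<Rightarrow> nat"
  where "bit_b1 \<nu> \<alpha> =
    (if gauss_jacobi \<alpha> \<nu> \<in> {1, \<i>\<^sub>\<int>} then 1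
     else if gauss_jacobi \<alpha> \<nu> \<in> {- 1, - \<i>\<^sub>\<int>} then 0
     else undefined)"

end

(*
  Both norms are 5 mod 8, so -1 has quartic symbol -1 modulo pi1 and modulo pi2, hence symbol 1
  modulo nu. Since xi is congruent to 1 modulo pi1 and to -1 modulo pi2, the symbol of xi modulo nu
  is -1. Thus multiplication by -1 flips the first bit and keeps the second, while multiplication
  by xi flips the second.
*)
theory Submission
  imports Defs "HOL-Number_Theory.Residues"
begin

section \<open>Congruence arithmetic in the Gaussian integers\<close>

lemma gauss_cong_refl [simp]: "[a = a] (gmod m)"
  by (simp add: gauss_cong_def)

lemma gauss_cong_sym: "[a = b] (gmod m) \<Longrightarrow> [b = a] (gmod m)"
  unfolding gauss_cong_def by (subst dvd_minus_iff [symmetric]) simp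

lemma gauss_cong_trans: "[a = b] (gmod m) \<Longrightarrow> [b = c] (gmod m) \<Longrightarrow> [a = c] (gmod m)"
  unfolding gauss_cong_def using dvd_add [of m "a - b" "b - c"] by simp

lemma gauss_cong_mult:
  assumes "[a = b] (gmod m)" "[c = d] (gmod m)"
  shows "[a * c = b * d] (gmod m)"
proof -
  have "a * c - b * d = (a - b) * c + b * (c - d)"
    by (simp add: algebra_simps)
  with assms show ?thesis
    unfolding gauss_cong_def by simp
qed

lemma gauss_cong_pow: "[a = b] (gmod m) \<Longrightarrow> [a ^ n = b ^ n] (gmod m)"
  by (induction n) (auto intro: gauss_cong_mult)

lemma gauss_cong_dvd_iff: "[a = b] (gmod m) \<Longrightarrow> m dvd a \<longleftrightarrow> m dvd b"
  unfolding gauss_cong_def using dvd_add_left_iff [of m "a - b" b] dvd_add_right_iff [of m "a - b" b]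
  by simp

section \<open>Norms, embedded integers and primality of the norm\<close>

lemma gauss_norm_dvd: "a dvd b \<Longrightarrow> gauss_norm a dvd gauss_norm b"
  by (auto simp: gauss_norm_mult)

lemma gauss_i_squared: "\<i>\<^sub>\<int> * \<i>\<^sub>\<int> = - 1"
  by (simp add: gauss_int_eq_iff)

lemma ReZ_ImZ_of_nat [simp]: "ReZ (of_nat n) = int n" "ImZ (of_nat n) = 0"
  by (induction n) auto

lemma ReZ_ImZ_of_int [simp]: "ReZ (of_int n) = n" "ImZ (of_int n) = 0"
  by (cases n; simp)+

lemma gauss_mult_cnj: "z * gauss_cnj z = of_int (gauss_norm z)"
  by (simp add: gauss_int_eq_iff gauss_norm_def power2_eq_square)

text \<open>With a natural number \<open>k\<close> the exponent
  \<open>(gauss_norm z - 1) div 4\<close> becomes \<open>2 * k + 1\<close>, visibly odd.\<close>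

lemma gauss_norm_mod_8_eq_5E:
  assumes "gauss_norm z mod 8 = 5"
  obtains k where "gauss_norm z = int (8 * k + 5)"
proof
  have "gauss_norm z = 8 * (gauss_norm z div 8) + 5"
    using assms mult_div_mod_eq [of 8 "gauss_norm z"] by simp
  then show "gauss_norm z = int (8 * nat (gauss_norm z div 8) + 5)"
    using gauss_norm_nonneg [of z] by (simp add: pos_imp_zdiv_nonneg_iff)
qed

text \<open>\<open>z\<close> divides \<open>z * gauss_cnj z\<close>, which is its norm. This carries
  integer congruences modulo the norm over to congruences modulo \<open>z\<close>.\<close>

lemma gauss_dvd_of_int: "gauss_norm z dvd n \<Longrightarrow> z dvd of_int n"
  by (metis dvd_def dvd_mult2 gauss_mult_cnj of_int_mult)

text \<open>Split off one rational prime of \<open>n\<close>: primality of \<open>z\<close> sends it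
  into that factor or into the smaller cofactor, where induction applies.\<close>

lemma prime_elem_dvd_of_nat:
  fixes z :: gauss_int
  assumes "prime_elem z" "z dvd of_nat n" "n > 0"
  obtains p where "prime p" "z dvd of_nat p"
  using assms(2,3)
proof (induction n arbitrary: thesis rule: less_induct)
  case (less n)
  have "n \<noteq> 1"
    using assms(1) less.prems by auto
  then obtain p m where p: "prime p" "n = p * m"
    by (metis prime_factor_nat dvd_def)
  then consider "z dvd of_nat p" | "z dvd of_nat m"
    using less.prems assms(1) prime_elem_dvd_mult_iff [of z] by auto
  then show ?case
  proof cases
    case 1
    with p less.prems show ?thesis by blast
  next
    case 2
    moreover have "0 < m" "m < n"
      using p less.prems prime_gt_1_nat [of p] by auto
    ultimately show ?thesis
      using less.IH [of m] less.prems by blast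
  qed
qed

text \<open>\<open>z\<close> divides its norm, hence some rational prime \<open>p\<close>. Taking
  norms, \<open>gauss_norm z\<close> divides \<open>p ^ 2\<close>, so it is 1, \<open>p\<close> or
  \<open>p ^ 2\<close>. Neither 1 nor a square is 5 modulo 8.\<close>

lemma prime_gauss_norm:
  assumes "prime_elem z" "gauss_norm z mod 8 = 5"
  shows "prime (gauss_norm z)"
proof -
  have "z dvd of_nat (nat (gauss_norm z))"
    using gauss_dvd_of_int [of z "gauss_norm z"]
    by (metis dvd_refl gauss_norm_nonneg int_nat_eq of_int_of_nat_eq)
  moreover have "nat (gauss_norm z) > 0"
    using assms(2) gauss_norm_nonneg [of z] by (cases "gauss_norm z = 0") auto
  ultimately obtain p where p: "prime p" "z dvd of_nat p"
    using prime_elem_dvd_of_nat [OF assms(1)] by blast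
  have "gauss_norm z dvd int p ^ 2"
    using gauss_norm_dvd [OF p(2)] by (simp add: gauss_norm_def)
  then obtain i where i: "i \<le> 2" "gauss_norm z = int p ^ i"
    using p(1) divides_primepow [of "int p" "gauss_norm z" 2] by auto
  have "gauss_norm z \<noteq> int p ^ 2"
  proof
    assume *: "gauss_norm z = int p ^ 2"
    have "(int p mod 8) ^ 2 mod 8 \<noteq> 5"
    proof -
      have "int p mod 8 \<in> {0..<8}" by simp
      also have "{0..<8} = {0,1,2,3,4,5,6,7::int}" by auto
      finally show ?thesis by auto
    qed
    with * assms(2) show False
      by (simp add: power_mod)
  qed
  moreover have "i \<noteq> 0"
    using assms(2) i(2) by (intro notI) simp
  ultimately have "i = 1"
    using i by (metis One_nat_def Suc_1 le_SucE le_zero_eq)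
  with i p show ?thesis by simp
qed

section \<open>Residue field modulo a Gaussian prime\<close>

text \<open>If the norm p of z is prime, \<open>\<int> \<rightarrow> \<int>[i]/(z)\<close> is surjective: the imaginary part of z is
  invertible mod p, so i is congruent to an integer.\<close>

lemma gauss_cong_of_int:
  assumes "prime (gauss_norm z)"
  obtains n where "[\<alpha> = of_int n] (gmod z)"
proof -
  define p where "p = gauss_norm z"
  have p: "prime p" "p = ReZ z ^ 2 + ImZ z ^ 2"
    using assms by (auto simp: p_def gauss_norm_def)
  \<comment> \<open>Otherwise \<open>p\<close> divides both coordinates, and \<open>p ^ 2\<close>
    divides the sum of their squares, which is \<open>p\<close>.\<close>
  have "\<not> p dvd ImZ z"
  proof
    assume *: "p dvd ImZ z"
    then have "p dvd ReZ z ^ 2"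
      using p(2) by (metis dvd_add_left_iff dvd_refl dvd_power_same dvd_mult power2_eq_square)
    then have "p dvd ReZ z"
      using p(1) prime_dvd_power by blast
    with * have "p ^ 2 dvd ReZ z ^ 2 + ImZ z ^ 2"
      by (intro dvd_add dvd_power_same)
    then have "p ^ 2 dvd p ^ 1"
      using p(2) by simp
    then show False
      using p(1) prime_gt_1_int [of p] by (auto simp: power2_eq_square)
  qed
  then have "coprime (ImZ z) p"
    using p(1) prime_imp_coprime coprime_commute by blast
  then obtain c where c: "[ImZ z * c = 1] (mod p)"
    using cong_solve_coprime_int by blast
  have "z dvd of_int (1 - ImZ z * c)"
    using c by (intro gauss_dvd_of_int) (simp add: cong_iff_dvd_diff p_def dvd_diff_commute)
  \<comment> \<open>Since \<open>c\<close> inverts \<open>ImZ z\<close>, the multiple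
    \<open>c * z\<close> has imaginary part 1 modulo \<open>p\<close>; hence i is congruent to
    \<open>- (ReZ z * c)\<close>.\<close>
  then have "z dvd \<i>\<^sub>\<int> * of_int (1 - ImZ z * c) + of_int c * z"
    by simp
  also have "\<dots> = \<i>\<^sub>\<int> - of_int (- (ReZ z * c))"
    by (simp add: gauss_int_eq_iff)
  finally have "z dvd of_int (ImZ \<alpha>) * (\<i>\<^sub>\<int> - of_int (- (ReZ z * c)))"
    by (rule dvd_mult)
  also have "\<dots> = \<alpha> - of_int (ReZ \<alpha> - ImZ \<alpha> * ReZ z * c)"
    by (simp add: gauss_int_eq_iff)
  finally show ?thesis
    unfolding gauss_cong_def [symmetric] by (rule that)
qed

text \<open>Modulo \<open>z\<close>, \<open>\<alpha>\<close> is an ordinary integer, so Fermat's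
  little theorem for the rational prime \<open>gauss_norm z\<close> applies.\<close>

lemma gauss_fermat:
  assumes "prime (gauss_norm z)" "\<not> z dvd \<alpha>"
  shows "[\<alpha> ^ nat (gauss_norm z - 1) = 1] (gmod z)"
proof -
  define p where "p = nat (gauss_norm z)"
  have p: "prime p" "int p = gauss_norm z"
    using assms(1) by (auto simp: p_def)
  obtain n where n: "[\<alpha> = of_int n] (gmod z)"
    using gauss_cong_of_int [OF assms(1)] by blast
  \<comment> \<open>A natural representative is chosen because \<open>fermat_theorem\<close> is used
    over the natural numbers.\<close>
  define m where "m = nat (n mod int p)"
  have "int p dvd n - int m"
    using prime_gt_0_nat [OF p(1)] by (simp add: m_def minus_mod_eq_mult_div)
  then have "z dvd of_int (n - int m)"
    using p(2) by (intro gauss_dvd_of_int) simp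
  then have m: "[\<alpha> = of_nat m] (gmod z)"
    using n by (intro gauss_cong_trans [OF n]) (simp add: gauss_cong_def)
  have "\<not> p dvd m"
  proof
    assume "p dvd m"
    then have "z dvd of_int (int m)"
      by (intro gauss_dvd_of_int) (simp flip: p(2))
    then show False
      using assms(2) gauss_cong_dvd_iff [OF m] by simp
  qed
  then have "[m ^ (p - 1) = 1] (mod p)"
    using fermat_theorem p(1) by blast
  then have "int p dvd int m ^ (p - 1) - 1"
    by (metis cong_iff_dvd_diff cong_int_iff of_nat_1 of_nat_power)
  then have "z dvd of_int (int m ^ (p - 1) - 1)"
    using p(2) by (intro gauss_dvd_of_int) simp
  then have "[of_nat m ^ (p - 1) = 1] (gmod z)"
    by (simp add: gauss_cong_def)
  moreover have "nat (gauss_norm z - 1) = p - 1"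
    using p(2) by linarith
  ultimately show ?thesis
    using gauss_cong_pow [OF m] gauss_cong_trans by metis
qed

section \<open>Values of the quartic symbol\<close>

text \<open>Distinct units differ by an element of norm 2 or 4, while \<open>z\<close> has norm at
  least 5. This makes the symbol well defined and separates 1 from -1 modulo
  \<open>z\<close>.\<close>

lemma gauss_units_cong_imp_eq:
  assumes "u \<in> {1, \<i>\<^sub>\<int>, - 1, - \<i>\<^sub>\<int>}" "v \<in> {1, \<i>\<^sub>\<int>, - 1, - \<i>\<^sub>\<int>}"
    and "[u = v] (gmod z)" "gauss_norm z mod 8 = 5"
  shows "u = v"
proof (rule ccontr)
  assume "u \<noteq> v"
  with assms(1,2) have "gauss_norm (u - v) \<in> {2, 4}"
    by (auto simp: gauss_norm_def)
  moreover have "gauss_norm z dvd gauss_norm (u - v)"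
    using assms(3) by (intro gauss_norm_dvd) (simp add: gauss_cong_def)
  ultimately have "gauss_norm z \<le> 4"
    using zdvd_imp_le [of "gauss_norm z"] by fastforce
  moreover have "gauss_norm z \<ge> 5"
    using assms(4) gauss_norm_nonneg [of z] by presburger
  ultimately show False by simp
qed

lemma quartic_symbol_eqI:
  assumes "\<not> z dvd \<alpha>" "gauss_norm z mod 8 = 5" "u \<in> {1, \<i>\<^sub>\<int>, - 1, - \<i>\<^sub>\<int>}"
    and "[\<alpha> ^ nat ((gauss_norm z - 1) div 4) = u] (gmod z)"
  shows "quartic_symbol \<alpha> z = u"
proof -
  have "(THE u. u \<in> {1, \<i>\<^sub>\<int>, - 1, - \<i>\<^sub>\<int>} \<and>
      [\<alpha> ^ nat ((gauss_norm z - 1) div 4) = u] (gmod z)) = u"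
  proof (rule the_equality)
    fix v
    assume v: "v \<in> {1, \<i>\<^sub>\<int>, - 1, - \<i>\<^sub>\<int>} \<and>
      [\<alpha> ^ nat ((gauss_norm z - 1) div 4) = v] (gmod z)"
    then have "[v = u] (gmod z)"
      using gauss_cong_trans [OF gauss_cong_sym assms(4)] by blast
    with v assms(2,3) show "v = u"
      using gauss_units_cong_imp_eq by blast
  qed (use assms(3,4) in blast)
  with assms(1) show ?thesis
    by (simp only: quartic_symbol_def if_False)
qed

text \<open>By Fermat the power \<open>x\<close> satisfies \<open>x ^ 4 = 1\<close> modulo
  \<open>z\<close>. Over the Gaussian integers \<open>x ^ 4 - 1\<close> splits into linear factors,
  and the prime \<open>z\<close> divides one of them.\<close>

lemma quartic_symbol_props:
  assumes "prime_elem z" "gauss_norm z mod 8 = 5" "\<not> z dvd \<alpha>"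
  shows "quartic_symbol \<alpha> z \<in> {1, \<i>\<^sub>\<int>, - 1, - \<i>\<^sub>\<int>}"
    and "[\<alpha> ^ nat ((gauss_norm z - 1) div 4) = quartic_symbol \<alpha> z] (gmod z)"
proof -
  define x where "x = \<alpha> ^ nat ((gauss_norm z - 1) div 4)"
  obtain k where "gauss_norm z = int (8 * k + 5)"
    using gauss_norm_mod_8_eq_5E [OF assms(2)] .
  then have "gauss_norm z - 1 = int (2 * k + 1) * 4"
    by simp
  then have "nat (gauss_norm z - 1) = nat ((gauss_norm z - 1) div 4) * 4"
    by (simp only: nonzero_mult_div_cancel_right) simp
  then have "x ^ 4 = \<alpha> ^ nat (gauss_norm z - 1)"
    by (simp add: x_def power_mult)
  then have "z dvd x ^ 4 - 1"
    using gauss_fermat [OF prime_gauss_norm] assms by (simp add: gauss_cong_def)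
  \<comment> \<open>Each factor is kept in the form \<open>x - u\<close>, so that its divisibility
    is literally a congruence.\<close>
  also have "x ^ 4 - 1 = (x - 1) * (x - (- 1)) * ((x - \<i>\<^sub>\<int>) * (x - (- \<i>\<^sub>\<int>)))"
    using gauss_i_squared by (simp add: algebra_simps power4_eq_xxxx)
  finally have "\<exists>u\<in>{1, \<i>\<^sub>\<int>, - 1, - \<i>\<^sub>\<int>}. [x = u] (gmod z)"
    using assms(1) by (simp only: prime_elem_dvd_mult_iff gauss_cong_def) blast
  then obtain u where u: "u \<in> {1, \<i>\<^sub>\<int>, - 1, - \<i>\<^sub>\<int>}" "[x = u] (gmod z)" ..
  then have "quartic_symbol \<alpha> z = u"
    using quartic_symbol_eqI assms by (simp add: x_def)
  with u show "quartic_symbol \<alpha> z \<in> {1, \<i>\<^sub>\<int>, - 1, - \<i>\<^sub>\<int>}"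
    "[\<alpha> ^ nat ((gauss_norm z - 1) div 4) = quartic_symbol \<alpha> z] (gmod z)"
    by (simp_all add: x_def)
qed

lemma quartic_symbol_cong:
  assumes "[a = b] (gmod z)"
  shows "quartic_symbol a z = quartic_symbol b z"
proof -
  have "[a ^ n = u] (gmod z) \<longleftrightarrow> [b ^ n = u] (gmod z)" for n u
    using assms gauss_cong_pow gauss_cong_sym gauss_cong_trans by blast
  then show ?thesis
    using gauss_cong_dvd_iff [OF assms] by (simp add: quartic_symbol_def)
qed

text \<open>Norm 5 modulo 8 makes the exponent odd, so the sign survives the power. If
  \<open>z\<close> divides \<open>\<alpha>\<close>, both sides are 0.\<close>

lemma quartic_symbol_minus:
  assumes "prime_elem z" "gauss_norm z mod 8 = 5"
  shows "quartic_symbol (- \<alpha>) z = - quartic_symbol \<alpha> z"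
proof (cases "z dvd \<alpha>")
  case True
  then show ?thesis by (simp add: quartic_symbol_def)
next
  case False
  define n where "n = nat ((gauss_norm z - 1) div 4)"
  obtain k where "gauss_norm z = int (8 * k + 5)"
    using gauss_norm_mod_8_eq_5E [OF assms(2)] .
  then have "gauss_norm z - 1 = int (2 * k + 1) * 4"
    by simp
  then have "n = 2 * k + 1"
    unfolding n_def by simp
  then have "odd n"
    by simp
  then have "[(- \<alpha>) ^ n = - quartic_symbol \<alpha> z] (gmod z)"
    using gauss_cong_mult [OF gauss_cong_refl [of "- 1"] quartic_symbol_props(2) [OF assms False]]
    by (simp add: n_def)
  then show ?thesis
    using quartic_symbol_props(1) [OF assms False] assms False
    by (intro quartic_symbol_eqI) (auto simp: n_def)
qed

section \<open>Unit values and the two bits\<close>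

lemma gauss_units_mult_closed:
  "u \<in> {1, \<i>\<^sub>\<int>, - 1, - \<i>\<^sub>\<int>} \<Longrightarrow> v \<in> {1, \<i>\<^sub>\<int>, - 1, - \<i>\<^sub>\<int>} \<Longrightarrow> u * v \<in> {1, \<i>\<^sub>\<int>, - 1, - \<i>\<^sub>\<int>}"
  using gauss_i_squared by auto

text \<open>Negation flips the sign of the coordinate that decides the bit;
  \<open>\<alpha> \<noteq> 0\<close> keeps both sides out of the \<open>undefined\<close>
  branch.\<close>

lemma bit_b0_minus: "\<alpha> \<noteq> 0 \<Longrightarrow> bit_b0 (- \<alpha>) \<noteq> bit_b0 \<alpha>"
  by (auto simp: bit_b0_def gauss_int_eq_iff)

text \<open>Negation swaps {1, i} with {-1, -i}; the membership hypothesis excludes the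
  \<open>undefined\<close> branch.\<close>

lemma bit_b1_neq:
  assumes "gauss_jacobi a \<nu> \<in> {1, \<i>\<^sub>\<int>, - 1, - \<i>\<^sub>\<int>}" "gauss_jacobi b \<nu> = - gauss_jacobi a \<nu>"
  shows "bit_b1 \<nu> b \<noteq> bit_b1 \<nu> a"
  using assms by (auto simp: bit_b1_def gauss_int_eq_iff)

section \<open>Square roots modulo the product and their bits\<close>

theorem theorem2:
  fixes \<pi>1 \<pi>2 \<nu> \<xi>1 \<xi>2 \<xi> \<beta> \<gamma> :: gauss_int and S :: "gauss_int set"
  assumes "prime_elem \<pi>1" and "prime_elem \<pi>2"
    and "primary \<pi>1" and "primary \<pi>2"
    and "coprime \<pi>1 \<pi>2"
    and "gauss_norm \<pi>1 mod 8 = 5" and "gauss_norm \<pi>2 mod 8 = 5"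
    and "\<nu> = \<pi>1 * \<pi>2"
    and "\<xi>1 + \<xi>2 = 1" and "\<pi>2 dvd \<xi>1" and "\<pi>1 dvd \<xi>2"
    and "\<xi> = \<xi>1 - \<xi>2"
    and "gauss_quad_residue \<nu> \<beta>"
    and "[\<gamma> ^ 2 = \<beta>] (gmod \<nu>)"
    and "S = {\<gamma>, - \<gamma>, \<gamma> * \<xi>, - (\<gamma> * \<xi>)}"
  shows "[\<xi> ^ 2 = 1] (gmod \<nu>) \<and>
    card S = 4 \<and>
    (\<forall>\<delta>. [\<delta> ^ 2 = \<beta>] (gmod \<nu>) \<longleftrightarrow> (\<exists>!\<alpha>\<in>S. [\<delta> = \<alpha>] (gmod \<nu>))) \<and>
    inj_on (\<lambda>\<alpha>. (bit_b0 \<alpha>, bit_b1 \<nu> \<alpha>)) S"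
proof -
  note S = assms(15)
  \<comment> \<open>Coprimality lets every congruence modulo \<open>\<nu>\<close> be tested at the
    two primes separately.\<close>
  have \<nu>_dvd: "\<nu> dvd x \<longleftrightarrow> \<pi>1 dvd x \<and> \<pi>2 dvd x" for x
  proof
    assume x: "\<pi>1 dvd x \<and> \<pi>2 dvd x"
    then obtain k where k: "x = \<pi>1 * k"
      by blast
    have "\<not> \<pi>2 dvd \<pi>1"
      using assms(2,5) coprime_common_divisor [of \<pi>1 \<pi>2 \<pi>2] prime_elem_not_unit by auto
    with x k assms(2) have "\<pi>2 dvd k"
      by (simp add: prime_elem_dvd_mult_iff)
    with k show "\<nu> dvd x"
      by (simp add: assms(8))
  next
    assume "\<nu> dvd x"
    then show "\<pi>1 dvd x \<and> \<pi>2 dvd x"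
      unfolding assms(8) by (metis dvd_mult_left dvd_mult_right)
  qed
  have "\<xi>1 = 1 - \<xi>2"
    using assms(9) by (simp add: eq_diff_eq)
  \<comment> \<open>\<open>\<pi>1\<close> divides \<open>\<xi>2\<close> and \<open>\<pi>2\<close>
    divides \<open>\<xi>1\<close>, so these identities yield the residues 1 and -1 of
    \<open>\<xi>\<close>.\<close>
  then have \<xi>_1: "\<xi> - 1 = - 2 * \<xi>2" and \<xi>_2: "\<xi> - (- 1) = 2 * \<xi>1"
    by (simp_all add: assms(12) algebra_simps)
  have \<xi>_cong: "[\<xi> = 1] (gmod \<pi>1)" "[\<xi> = - 1] (gmod \<pi>2)"
    unfolding gauss_cong_def \<xi>_1 \<xi>_2 using assms(10,11) by (auto intro: dvd_mult)
  have \<gamma>\<xi>: "[\<gamma> * \<xi> = \<gamma>] (gmod \<pi>1)" "[\<gamma> * \<xi> = - \<gamma>] (gmod \<pi>2)"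
    using gauss_cong_mult [OF gauss_cong_refl [of \<gamma>]] \<xi>_cong by fastforce+
  have "\<nu> dvd (\<xi> - 1) * (\<xi> - (- 1))"
    unfolding \<nu>_dvd using \<xi>_cong by (auto simp: gauss_cong_def simp del: diff_minus_eq_add)
  then have \<xi>_sq: "[\<xi> ^ 2 = 1] (gmod \<nu>)"
    by (simp add: gauss_cong_def algebra_simps power2_eq_square)

  have \<beta>_\<gamma>: "[x = \<beta>] (gmod \<nu>) \<longleftrightarrow> [x = \<gamma> ^ 2] (gmod \<nu>)" for x
    using assms(14) gauss_cong_sym gauss_cong_trans by blast
  \<comment> \<open>A common prime divisor of \<open>\<gamma>\<close> and \<open>\<nu>\<close> would
    also divide \<open>\<beta>\<close>, which is coprime to \<open>\<nu>\<close>.\<close>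
  have not_dvd: "\<not> z dvd \<gamma>" if "prime_elem z" "z dvd \<nu>" for z
  proof
    assume "z dvd \<gamma>"
    then have "z dvd \<gamma> ^ 2"
      by (simp add: power2_eq_square)
    moreover have "[\<gamma> ^ 2 = \<beta>] (gmod z)"
      using assms(14) that(2) dvd_trans unfolding gauss_cong_def by blast
    ultimately have "z dvd \<beta>"
      using gauss_cong_dvd_iff by blast
    with that assms(13) have "is_unit z"
      unfolding gauss_quad_residue_def using coprime_common_divisor by blast
    with that(1) show False by auto
  qed
  have nd: "\<not> \<pi>1 dvd \<gamma>" "\<not> \<pi>2 dvd \<gamma>"
    using not_dvd assms(1,2,8) by auto
  \<comment> \<open>No \<open>\<delta>\<close> has both signs at one prime: subtracting gives
    \<open>z dvd 2 * \<gamma>\<close>, so 1 and -1 would be congruent. Writing 2 as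
    \<open>1 - (- 1)\<close> exposes this congruence.\<close>
  have incong: "\<not> (z dvd \<delta> - \<gamma> \<and> z dvd \<delta> + \<gamma>)"
    if "prime_elem z" "gauss_norm z mod 8 = 5" "\<not> z dvd \<gamma>" for z \<delta>
  proof
    assume "z dvd \<delta> - \<gamma> \<and> z dvd \<delta> + \<gamma>"
    then have "z dvd (\<delta> + \<gamma>) - (\<delta> - \<gamma>)"
      using dvd_diff by blast
    then have "z dvd (1 - (- 1)) * \<gamma>"
      by (simp add: algebra_simps)
    then have "[1 = - 1] (gmod z)"
      using that prime_elem_dvd_mult_iff gauss_cong_def by blast
    then show False
      using gauss_units_cong_imp_eq [of 1 "- 1" z] that(2) by (simp add: gauss_int_eq_iff)
  qed

  \<comment> \<open>The four candidates realise the four sign patterns of \<open>\<gamma>\<close> at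
    the pair of primes.\<close>
  have cong_iff:
    "[\<delta> = \<gamma>] (gmod \<nu>) \<longleftrightarrow> \<pi>1 dvd \<delta> - \<gamma> \<and> \<pi>2 dvd \<delta> - \<gamma>"
    "[\<delta> = - \<gamma>] (gmod \<nu>) \<longleftrightarrow> \<pi>1 dvd \<delta> + \<gamma> \<and> \<pi>2 dvd \<delta> + \<gamma>"
    "[\<delta> = \<gamma> * \<xi>] (gmod \<nu>) \<longleftrightarrow> \<pi>1 dvd \<delta> - \<gamma> \<and> \<pi>2 dvd \<delta> + \<gamma>"
    "[\<delta> = - (\<gamma> * \<xi>)] (gmod \<nu>) \<longleftrightarrow> \<pi>1 dvd \<delta> + \<gamma> \<and> \<pi>2 dvd \<delta> - \<gamma>" for \<delta>
  proof -
    show "[\<delta> = \<gamma>] (gmod \<nu>) \<longleftrightarrow> \<pi>1 dvd \<delta> - \<gamma> \<and> \<pi>2 dvd \<delta> - \<gamma>"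
      "[\<delta> = - \<gamma>] (gmod \<nu>) \<longleftrightarrow> \<pi>1 dvd \<delta> + \<gamma> \<and> \<pi>2 dvd \<delta> + \<gamma>"
      by (simp_all add: gauss_cong_def \<nu>_dvd)
    have *: "z dvd \<delta> - a \<longleftrightarrow> z dvd \<delta> - b" if "[a = b] (gmod z)" for z a b
      using that gauss_cong_sym gauss_cong_trans unfolding gauss_cong_def [symmetric] by blast
    have "[- (\<gamma> * \<xi>) = - \<gamma>] (gmod \<pi>1)" "[- (\<gamma> * \<xi>) = \<gamma>] (gmod \<pi>2)"
      using gauss_cong_mult [OF gauss_cong_refl [of "- 1"]] \<gamma>\<xi> by fastforce+
    then show "[\<delta> = \<gamma> * \<xi>] (gmod \<nu>) \<longleftrightarrow> \<pi>1 dvd \<delta> - \<gamma> \<and> \<pi>2 dvd \<delta> + \<gamma>"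
      "[\<delta> = - (\<gamma> * \<xi>)] (gmod \<nu>) \<longleftrightarrow> \<pi>1 dvd \<delta> + \<gamma> \<and> \<pi>2 dvd \<delta> - \<gamma>"
      unfolding gauss_cong_def [of _ _ \<nu>] \<nu>_dvd using * \<gamma>\<xi> by (metis diff_minus_eq_add)+
  qed
  \<comment> \<open>A difference of squares factors, so each prime chooses its sign
    independently.\<close>
  have sq_iff: "[\<delta> ^ 2 = \<beta>] (gmod \<nu>) \<longleftrightarrow>
      (\<pi>1 dvd \<delta> - \<gamma> \<or> \<pi>1 dvd \<delta> + \<gamma>) \<and> (\<pi>2 dvd \<delta> - \<gamma> \<or> \<pi>2 dvd \<delta> + \<gamma>)" for \<delta>
  proof -
    have "\<delta> ^ 2 - \<gamma> ^ 2 = (\<delta> - \<gamma>) * (\<delta> + \<gamma>)"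
      by (simp add: algebra_simps power2_eq_square)
    then show ?thesis
      unfolding \<beta>_\<gamma> using assms(1,2)
      by (simp add: gauss_cong_def \<nu>_dvd prime_elem_dvd_mult_iff)
  qed
  note incong1 = incong [OF assms(1,6) nd(1)] and incong2 = incong [OF assms(2,7) nd(2)]
  \<comment> \<open>Two members of \<open>S\<close> with different sign patterns would give
    \<open>\<delta>\<close> both signs at some prime.\<close>
  have unique: "a = b" if "a \<in> S" "b \<in> S" "[\<delta> = a] (gmod \<nu>)" "[\<delta> = b] (gmod \<nu>)" for a b \<delta>
    using that incong1 [of \<delta>] incong2 [of \<delta>] unfolding S by (auto simp: cong_iff)
  have roots: "[\<delta> ^ 2 = \<beta>] (gmod \<nu>) \<longleftrightarrow> (\<exists>!\<alpha>\<in>S. [\<delta> = \<alpha>] (gmod \<nu>))" for \<delta>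
  proof -
    have "[\<delta> ^ 2 = \<beta>] (gmod \<nu>) \<longleftrightarrow> (\<exists>\<alpha>\<in>S. [\<delta> = \<alpha>] (gmod \<nu>))"
      unfolding S by (auto simp: cong_iff sq_iff)
    also have "\<dots> \<longleftrightarrow> (\<exists>!\<alpha>\<in>S. [\<delta> = \<alpha>] (gmod \<nu>))"
      using unique by blast
    finally show ?thesis .
  qed
  \<comment> \<open>Equal candidates would share a sign pattern, against \<open>incong\<close>.
    Being different from their negatives, \<open>\<gamma>\<close> and
    \<open>\<gamma> * \<xi>\<close> are also nonzero.\<close>
  have "\<gamma> \<noteq> - \<gamma>" "\<gamma> \<noteq> \<gamma> * \<xi>" "\<gamma> \<noteq> - (\<gamma> * \<xi>)" "- \<gamma> \<noteq> \<gamma> * \<xi>" "- \<gamma> \<noteq> - (\<gamma> * \<xi>)"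
    "\<gamma> * \<xi> \<noteq> - (\<gamma> * \<xi>)"
    using cong_iff [of \<gamma>] cong_iff [of "- \<gamma>"] cong_iff [of "\<gamma> * \<xi>"] cong_iff [of "- (\<gamma> * \<xi>)"]
      incong1 incong2 gauss_cong_refl by metis+
  then have card: "card S = 4" and nz: "\<gamma> \<noteq> 0" "\<gamma> * \<xi> \<noteq> 0"
    unfolding S by auto

  let ?J = "\<lambda>\<alpha>. gauss_jacobi \<alpha> \<nu>"
  have J: "?J \<alpha> = quartic_symbol \<alpha> \<pi>1 * quartic_symbol \<alpha> \<pi>2" for \<alpha>
    unfolding assms(8) by (rule gauss_jacobi_mult_primes [OF assms(1,2)])
  note minus = quartic_symbol_minus [OF assms(1,6)] quartic_symbol_minus [OF assms(2,7)]
  \<comment> \<open>Both factors change sign under negation, whereas for \<open>\<xi>\<close> below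
    only the factor at \<open>\<pi>2\<close> does.\<close>
  have J_minus: "?J (- \<alpha>) = ?J \<alpha>" for \<alpha>
    by (simp add: J minus)
  have J_\<xi>: "?J (\<gamma> * \<xi>) = - ?J \<gamma>"
    by (simp add: J quartic_symbol_cong [OF \<gamma>\<xi>(1)] quartic_symbol_cong [OF \<gamma>\<xi>(2)] minus)
  have "?J \<gamma> \<in> {1, \<i>\<^sub>\<int>, - 1, - \<i>\<^sub>\<int>}"
    unfolding J using assms(1,2,6,7) nd
    by (intro gauss_units_mult_closed quartic_symbol_props(1)) auto
  then have b1: "bit_b1 \<nu> (\<gamma> * \<xi>) \<noteq> bit_b1 \<nu> \<gamma>"
    using bit_b1_neq J_\<xi> by blast
  have b1_minus: "bit_b1 \<nu> (- \<alpha>) = bit_b1 \<nu> \<alpha>" for \<alpha>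
    by (simp add: bit_b1_def J_minus)
  \<comment> \<open>The second bit separates the pair of \<open>\<gamma>\<close> from the pair of
    \<open>\<gamma> * \<xi>\<close>; the first separates the two signs within each pair.\<close>
  have "inj_on (\<lambda>\<alpha>. (bit_b0 \<alpha>, bit_b1 \<nu> \<alpha>)) S"
    unfolding S inj_on_def
    using b1 b1 [symmetric] bit_b0_minus [OF nz(1)] bit_b0_minus [OF nz(2)]
      bit_b0_minus [OF nz(1), symmetric] bit_b0_minus [OF nz(2), symmetric]
    by (auto simp: b1_minus)
  with \<xi>_sq card roots show ?thesis
    by blast
qed

end
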